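(* For every complex number $a$, $$\sum_{i,j\geq 0}\frac{(-1)^iq^{i^2+2j^2+2ij-i-2j}a^{i+j}}{(q;q)_i(q^2;q^2)_j}=(aq;q^2)_\infty.$$
   Context: Here $q$ is a complex number with $0<|q|<1$. For $|p|<1$, $(a;p)_\infty=\prod_{n\ge 0}(1-ap^n)$, and $(a;p)_n=(a;p)_\infty/(ap^n;p)_\infty=\prod_{k=0}^{n-1}(1-ap^k)$ for integers $n\ge 0$. The sum runs over all pairs of nonnegative integers $(i,j)$; $0^0=1$. *)

theory Defs
  imports "HOL-Analysis.Analysis"
begin

definition qpoch_inf :: "complex \<Rightarrow> complex \<Rightarrow> complex" where
  "qpoch_inf a p = (\<Prod>n. 1 - a * p ^ n)"

(* The product form is used because the quotient (a;p)_inf / (a p^n;p)_inf is 0/0 when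
   a p^m = 1 for some m >= n. *)
definition qpoch :: "complex \<Rightarrow> complex \<Rightarrow> nat \<Rightarrow> complex" where
  "qpoch a p n = (\<Prod>k<n. 1 - a * p ^ k)"

lemma convergent_prod_qpoch_inf:
  fixes a p :: complex
  assumes "norm p < 1"
  shows "convergent_prod (\<lambda>n. 1 - a * p ^ n)"
proof -
  have "summable (\<lambda>n. norm (- (a * p ^ n)))"
    using assms by (simp add: norm_mult norm_power summable_geometric summable_mult)
  then have "summable (\<lambda>n. norm ((1 - a * p ^ n) - 1))"
    by (simp add: norm_minus_commute)
  then show ?thesis
    using abs_convergent_prod_conv_summable abs_convergent_prod_imp_convergent_prod by blast
qed

lemma qpoch_inf_has_prod:
  fixes a p :: complex
  assumes "norm p < 1"
  shows "(\<lambda>n. 1 - a * p ^ n) has_prod qpoch_inf a p"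
  unfolding qpoch_inf_def
  by (rule convergent_prod_has_prod[OF convergent_prod_qpoch_inf[OF assms]])

end

theory Submission
  imports Defs "HOL-Computational_Algebra.Formal_Power_Series"
begin

(* With n = i + j the exponent of q is n(n-1) + j(j-1).  Summing over j for fixed n yields the
   n-th coefficient of (z;q^2)_inf / (z;q)_inf = 1 / (qz;q^2)_inf, which is q^n / (q^2;q^2)_n,
   and what remains is Euler's expansion of (aq;q^2)_inf.  All these expansions are handled through
   the functional equations relating a series at z to the same series at pz. *)

section \<open>Finite Pochhammer products and binomial exponents\<close>

lemma qpoch_0 [simp]: "qpoch a p 0 = 1"
  by (simp add: qpoch_def)

lemma qpoch_Suc: "qpoch a p (Suc n) = qpoch a p n * (1 - a * p ^ n)"
  by (simp add: qpoch_def)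

lemma one_minus_power_neq_0:
  fixes p :: complex
  assumes "norm p < 1"
  shows "1 - p ^ Suc n \<noteq> 0"
proof
  assume "1 - p ^ Suc n = 0"
  then have "norm (p ^ Suc n) = 1"
    by (metis eq_iff_diff_eq_0 norm_one)
  moreover have "norm (p ^ Suc n) < 1"
    using assms by (simp add: norm_power power_less_one_iff del: power_Suc)
  ultimately show False by simp
qed

lemma qpoch_self_neq_0:
  assumes "norm p < 1"
  shows "qpoch p p n \<noteq> 0"
  using one_minus_power_neq_0[OF assms] by (auto simp: qpoch_def)

lemma Suc_choose_two: "Suc n choose 2 = n + (n choose 2)"
  by (simp add: numeral_2_eq_2)

lemma add_choose_two: "(i + j) choose 2 = (i choose 2) + (j choose 2) + i * j"
  by (induction i) (simp_all add: Suc_choose_two)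

lemma int_choose_two: "2 * int (n choose 2) = (int n)\<^sup>2 - int n"
  by (induction n) (simp_all add: Suc_choose_two power2_eq_square algebra_simps)

text \<open>Ratio test: the quotient of consecutive terms is
  \<open>s ^ n * norm x / norm (1 - p ^ Suc n)\<close>, which tends to 0. The base \<open>s\<close>
  is kept apart from \<open>p\<close> because the majorant in the theorem pairs powers of the norm
  of \<open>q\<^sup>2\<close> with \<open>qpoch q q\<close>.\<close>

lemma summable_power_choose_two_div_qpoch:
  fixes p x :: complex and s :: real
  assumes p: "norm p < 1" and s: "0 \<le> s" "s < 1"
  shows "summable (\<lambda>n. s ^ (n choose 2) * norm x ^ n / norm (qpoch p p n))"
proof -
  let ?u = "\<lambda>n. s ^ (n choose 2) * norm x ^ n / norm (qpoch p p n)"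
  have "(\<lambda>n. s ^ n * norm x / norm (1 - p ^ Suc n)) \<longlonglongrightarrow> 0 * norm x / norm (1 - (0::complex))"
    using s p by (intro tendsto_intros LIMSEQ_Suc LIMSEQ_power_zero LIMSEQ_realpow_zero) auto
  then have "eventually (\<lambda>n. s ^ n * norm x / norm (1 - p ^ Suc n) < 1 / 2) sequentially"
    by (rule order_tendstoD) simp
  then obtain N where N: "\<And>n. n \<ge> N \<Longrightarrow> s ^ n * norm x / norm (1 - p ^ Suc n) < 1 / 2"
    by (auto simp: eventually_sequentially)
  show ?thesis
  proof (rule summable_ratio_test[of "1 / 2" N])
    fix n assume "N \<le> n"
    have eq: "?u (Suc n) = s ^ n * norm x / norm (1 - p ^ Suc n) * ?u n"
      by (simp add: Suc_choose_two qpoch_Suc norm_mult power_add mult_ac)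
    have "\<dots> \<le> 1 / 2 * ?u n"
      using N[OF \<open>N \<le> n\<close>] s by (intro mult_right_mono) auto
    with eq have "?u (Suc n) \<le> 1 / 2 * ?u n"
      by linarith
    moreover have "?u m \<ge> 0" for m
      using s by simp
    ultimately show "norm (?u (Suc n)) \<le> 1 / 2 * norm (?u n)"
      by (simp only: real_norm_def abs_of_nonneg)
  qed simp
qed

section \<open>Euler's expansion of (x;p)_inf in powers of x\<close>

definition euler_coeff :: "complex \<Rightarrow> nat \<Rightarrow> complex" where
  "euler_coeff p n = (-1) ^ n * p ^ (n choose 2) / qpoch p p n"

lemma euler_coeff_0 [simp]: "euler_coeff p 0 = 1"
  by (simp add: euler_coeff_def numeral_2_eq_2)

lemma euler_coeff_Suc:
  assumes "norm p < 1"
  shows "euler_coeff p (Suc n) * (1 - p ^ Suc n) = - (p ^ n * euler_coeff p n)"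
  using one_minus_power_neq_0[OF assms, of n] qpoch_self_neq_0[OF assms, of n]
  by (simp add: euler_coeff_def qpoch_Suc Suc_choose_two power_add)

lemma summable_euler_coeff:
  assumes "norm p < 1"
  shows "summable (\<lambda>n. euler_coeff p n * x ^ n)"
proof (rule summable_norm_cancel)
  show "summable (\<lambda>n. norm (euler_coeff p n * x ^ n))"
    using summable_power_choose_two_div_qpoch[OF assms, of "norm p" x] assms
    by (simp add: euler_coeff_def norm_mult norm_divide norm_power)
qed

text \<open>The series analogue of (x;p)_inf = (1 - x) (px;p)_inf; on coefficients it is the
  recurrence \<open>euler_coeff_Suc\<close>.\<close>

lemma euler_series_shift:
  assumes p: "norm p < 1"
  shows "(\<Sum>n. euler_coeff p n * x ^ n) = (1 - x) * (\<Sum>n. euler_coeff p n * (p * x) ^ n)"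
proof -
  let ?f = "\<lambda>x. \<Sum>n. euler_coeff p n * x ^ n"
  note summ = summable_euler_coeff[OF p]
  have diff: "(\<lambda>n. euler_coeff p n * x ^ n - euler_coeff p n * (p * x) ^ n) sums (?f x - ?f (p * x))"
    by (intro sums_diff summable_sums summ)
  have step: "euler_coeff p (Suc n) * x ^ Suc n - euler_coeff p (Suc n) * (p * x) ^ Suc n
      = - x * (euler_coeff p n * (p * x) ^ n)" for n
  proof -
    have "euler_coeff p (Suc n) * x ^ Suc n - euler_coeff p (Suc n) * (p * x) ^ Suc n
        = x ^ Suc n * (euler_coeff p (Suc n) * (1 - p ^ Suc n))"
      unfolding power_mult_distrib by (simp add: algebra_simps del: power_Suc)
    then show ?thesis
      unfolding euler_coeff_Suc[OF p] by (simp add: power_mult_distrib)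
  qed
  have "(\<lambda>n. - x * (euler_coeff p n * (p * x) ^ n)) sums (- x * ?f (p * x))"
    by (intro sums_mult summable_sums summ)
  \<comment> \<open>The term of index 0 of the difference vanishes, so the index shift leaves the
    sum unchanged.\<close>
  then have "(\<lambda>n. euler_coeff p n * x ^ n - euler_coeff p n * (p * x) ^ n) sums (- x * ?f (p * x))"
    unfolding step[symmetric]
      sums_Suc_iff[of "\<lambda>n. euler_coeff p n * x ^ n - euler_coeff p n * (p * x) ^ n"]
    by simp
  from sums_unique2[OF diff this] show ?thesis
    by (simp add: algebra_simps)
qed

text \<open>Iterating the shift pulls out \<open>qpoch x p N\<close> and leaves the series at
  \<open>x * p ^ N\<close>; this argument tends to 0, where the series is continuous with value
  1.\<close>

lemma euler_sums_qpoch_inf: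
  assumes p: "norm p < 1"
  shows "(\<lambda>n. euler_coeff p n * x ^ n) sums qpoch_inf x p"
proof -
  let ?f = "\<lambda>x. \<Sum>n. euler_coeff p n * x ^ n"
  have iter: "?f x = qpoch x p N * ?f (x * p ^ N)" for N
    by (induction N) (simp, simp add: qpoch_Suc euler_series_shift[OF p, of "x * p ^ _"] mult_ac)
  have "(\<lambda>N. x * p ^ N) \<longlonglongrightarrow> x * 0"
    using p by (intro tendsto_intros LIMSEQ_power_zero)
  then have lim: "(\<lambda>N. x * p ^ N) \<longlonglongrightarrow> 0"
    by simp
  have "isCont ?f 0"
    by (rule isCont_powser[of _ 1]) (use summable_euler_coeff[OF p, of 1] in auto)
  from isCont_tendsto_compose[OF this lim] have f0: "(\<lambda>N. ?f (x * p ^ N)) \<longlonglongrightarrow> 1"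
    by simp
  \<comment> \<open>The library's partial products include the factor of index N, hence
    \<open>Suc N\<close>.\<close>
  have "(\<lambda>N. qpoch x p (Suc N)) \<longlonglongrightarrow> qpoch_inf x p"
    using convergent_prod_LIMSEQ[OF convergent_prod_qpoch_inf[OF p, of x]]
    by (simp add: qpoch_def qpoch_inf_def lessThan_Suc_atMost)
  then have "(\<lambda>N. qpoch x p N) \<longlonglongrightarrow> qpoch_inf x p"
    by (simp only: filterlim_sequentially_Suc)
  from tendsto_mult[OF this f0] have "(\<lambda>N. ?f x) \<longlonglongrightarrow> qpoch_inf x p * 1"
    by (simp add: iter[symmetric])
  then have "?f x = qpoch_inf x p"
    by (simp add: LIMSEQ_const_iff)
  with summable_sums[OF summable_euler_coeff[OF p, of x]] show ?thesis
    by simp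
qed

section \<open>The sum over j for fixed n, by formal power series\<close>

abbreviation fps_dilate :: "complex \<Rightarrow> complex fps \<Rightarrow> complex fps" where
  "fps_dilate c F \<equiv> F oo (fps_const c * fps_X)"

lemma fps_dilate_euler:
  assumes p: "norm p < 1"
  shows "Abs_fps (euler_coeff p) = (1 - fps_X) * fps_dilate p (Abs_fps (euler_coeff p))"
proof (rule fps_ext)
  fix n
  show "fps_nth (Abs_fps (euler_coeff p)) n
      = fps_nth ((1 - fps_X) * fps_dilate p (Abs_fps (euler_coeff p))) n"
    using euler_coeff_Suc[OF p]
    by (cases n) (simp_all add: fps_compose_linear left_diff_distrib, simp add: algebra_simps)
qed

text \<open>\<open>A\<close> is the expansion of 1/(z;p)_inf, and the equation reflects 1/(pz;p)_inf
  = (1 - z)/(z;p)_inf.\<close>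

lemma fps_dilate_inverse_qpoch:
  assumes p: "norm p < 1"
  defines "A \<equiv> Abs_fps (\<lambda>n. 1 / qpoch p p n)"
  shows "fps_dilate p A = (1 - fps_X) * A"
proof (rule fps_ext)
  fix n
  show "fps_nth (fps_dilate p A) n = fps_nth ((1 - fps_X) * A) n"
    using one_minus_power_neq_0[OF p] qpoch_self_neq_0[OF p]
    by (cases n) (simp_all add: A_def fps_compose_linear left_diff_distrib qpoch_Suc divide_simps,
        simp_all add: algebra_simps)
qed

text \<open>The left side is a coefficient of the Cauchy product \<open>C\<close> of the series for
  (z;q^2)_inf and 1/(z;q)_inf. The functional equation of \<open>C\<close> gives a first-order
  recurrence, which with constant term 1 determines all coefficients.\<close>

lemma sum_euler_coeff_div_qpoch:
  assumes q: "norm q < 1"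
  shows "(\<Sum>j\<le>n. euler_coeff (q\<^sup>2) j / qpoch q q (n - j)) = q ^ n / qpoch (q\<^sup>2) (q\<^sup>2) n"
proof -
  define A where "A = Abs_fps (\<lambda>n. 1 / qpoch q q n)"
  define B where "B = Abs_fps (euler_coeff (q\<^sup>2))"
  define C where "C = B * A"
  have q2: "norm (q\<^sup>2) < 1"
    using q by (simp add: norm_power power_less_one_iff)
  have dA: "fps_dilate q A = (1 - fps_X) * A"
    unfolding A_def by (rule fps_dilate_inverse_qpoch[OF q])
  \<comment> \<open>The equation for \<open>A\<close> dilates by \<open>q\<close>, that for
    \<open>B\<close> by \<open>q\<^sup>2\<close>; applying the former twice makes them
    match.\<close>
  have "fps_dilate (q\<^sup>2) A = fps_dilate q (fps_dilate q A)"
    by (simp add: fps_compose_linear fps_eq_iff power_mult_distrib power2_eq_square)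
  also have "\<dots> = (1 - fps_const q * fps_X) * (1 - fps_X) * A"
    by (simp add: dA fps_compose_mult_distrib fps_compose_sub_distrib mult.assoc)
  finally have dA2: "fps_dilate (q\<^sup>2) A = (1 - fps_const q * fps_X) * (1 - fps_X) * A" .
  have dB: "B = (1 - fps_X) * fps_dilate (q\<^sup>2) B"
    unfolding B_def by (rule fps_dilate_euler[OF q2])
  have "fps_dilate (q\<^sup>2) C = fps_dilate (q\<^sup>2) B * fps_dilate (q\<^sup>2) A"
    by (simp add: C_def fps_compose_mult_distrib)
  \<comment> \<open>The factor \<open>1 - fps_X\<close> coming from \<open>A\<close> is exactly what
    turns the dilated \<open>B\<close> back into \<open>B\<close>.\<close>
  also have "\<dots> = (1 - fps_const q * fps_X) * ((1 - fps_X) * fps_dilate (q\<^sup>2) B) * A"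
    unfolding dA2 by (simp only: mult_ac)
  also have "\<dots> = (1 - fps_const q * fps_X) * C"
    unfolding dB[symmetric] by (simp only: C_def mult.assoc)
  finally have dC: "fps_dilate (q\<^sup>2) C = (1 - fps_const q * fps_X) * C" .
  have C_Suc: "fps_nth C (Suc n) * (1 - (q\<^sup>2) ^ Suc n) = q * fps_nth C n" for n
    using arg_cong[OF dC, of "\<lambda>F. fps_nth F (Suc n)"]
    by (simp add: fps_compose_linear left_diff_distrib mult.assoc) (simp add: algebra_simps)
  have "fps_nth C n = q ^ n / qpoch (q\<^sup>2) (q\<^sup>2) n"
  proof (induction n)
    case 0
    show ?case by (simp add: C_def A_def B_def)
  next
    case (Suc n)
    with C_Suc[of n] one_minus_power_neq_0[OF q2, of n] qpoch_self_neq_0[OF q2, of n]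
    show ?case by (simp add: qpoch_Suc divide_simps) (simp add: mult_ac)
  qed
  then show ?thesis
    by (simp add: C_def A_def B_def fps_mult_nth atLeast0AtMost)
qed

theorem theorem3p8:
  fixes q a :: complex
  assumes "0 < norm q" and "norm q < 1"
  shows "((\<lambda>(i, j). (-1) ^ i
             * q powi ((int i)\<^sup>2 + 2 * (int j)\<^sup>2 + 2 * int i * int j - int i - 2 * int j)
             * a ^ (i + j)
             / (qpoch q q i * qpoch (q\<^sup>2) (q\<^sup>2) j))
          has_sum qpoch_inf (a * q) (q\<^sup>2)) (UNIV :: (nat \<times> nat) set)"
proof -
  define p where "p = q\<^sup>2"
  define f where "f = (\<lambda>(i, j). (-1) ^ i * (p ^ ((i + j) choose 2) * p ^ (j choose 2))
      * a ^ (i + j) / (qpoch q q i * qpoch p p j))"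
  have p: "norm p < 1"
    using assms by (simp add: p_def norm_power power_less_one_iff)
  have powi: "q powi ((int i)\<^sup>2 + 2 * (int j)\<^sup>2 + 2 * int i * int j - int i - 2 * int j)
      = p ^ ((i + j) choose 2) * p ^ (j choose 2)" for i j
  proof -
    have "(int i)\<^sup>2 + 2 * (int j)\<^sup>2 + 2 * int i * int j - int i - 2 * int j
        = 2 * int ((i + j) choose 2) + 2 * int (j choose 2)"
      unfolding int_choose_two by (simp add: power2_eq_square algebra_simps)
    also have "\<dots> = int (2 * (((i + j) choose 2) + (j choose 2)))"
      by simp
    finally show ?thesis
      by (simp only: power_int_of_nat p_def power_mult power_add power_mult_distrib)
  qed
  \<comment> \<open>A product majorant for absolute convergence: of the exponent
    \<open>(i + j) choose 2\<close> only \<open>i choose 2\<close> is kept, which decouples the two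
    indices.\<close>
  define u where "u = (\<lambda>i. norm p ^ (i choose 2) * norm a ^ i / norm (qpoch q q i))"
  define v where "v = (\<lambda>j. norm p ^ (j choose 2) * norm a ^ j / norm (qpoch p p j))"
  have uv_nonneg: "u i \<ge> 0" "v i \<ge> 0" for i
    by (simp_all add: u_def v_def)
  have "summable u" "summable v"
    unfolding u_def v_def
    by (rule summable_power_choose_two_div_qpoch; use p assms in simp)+
  then have "u summable_on UNIV" "v summable_on UNIV"
    using uv_nonneg by (simp_all add: summable_on_UNIV_nonneg_real_iff)
  then have "(\<lambda>(i, j). u i * v j) summable_on UNIV \<times> UNIV"
    using uv_nonneg
    by (intro summable_on_SigmaI[where g = "\<lambda>i. u i * infsum v UNIV"])
       (auto intro!: has_sum_cmult_right summable_on_cmult_left)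
  then have "(\<lambda>(i, j). u i * v j) summable_on UNIV"
    by simp
  then have "(\<lambda>x. norm (f x)) summable_on UNIV"
  proof (rule Infinite_Sum.abs_summable_on_comparison_test')
    fix x :: "nat \<times> nat"
    obtain i j where x: "x = (i, j)" by force
    have "norm p ^ ((i + j) choose 2) \<le> norm p ^ (i choose 2)"
      using p by (intro power_decreasing) (auto simp: add_choose_two)
    then have "norm p ^ ((i + j) choose 2) * norm p ^ (j choose 2) * norm a ^ (i + j)
          / (norm (qpoch q q i) * norm (qpoch p p j))
        \<le> norm p ^ (i choose 2) * norm p ^ (j choose 2) * norm a ^ (i + j)
          / (norm (qpoch q q i) * norm (qpoch p p j))"
      by (intro divide_right_mono mult_right_mono) auto
    then show "norm (f x) \<le> (case x of (i, j) \<Rightarrow> u i * v j)"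
      by (simp add: x f_def u_def v_def norm_mult norm_divide norm_power power_add mult_ac)
  qed
  then have "f summable_on UNIV"
    by (rule abs_summable_summable)
  then obtain S where S: "(f has_sum S) UNIV"
    by (auto simp: summable_on_def)
  \<comment> \<open>Regrouping by n = i + j; the truncated subtraction is exact since j is at most
    n.\<close>
  have diagonal: "((\<lambda>(n, j). f (n - j, j)) has_sum S) (SIGMA n:UNIV. {..n})"
    using S by (subst has_sum_reindex_bij_witness[where S = "SIGMA n:UNIV. {..n}" and T = UNIV
          and j = "\<lambda>(n, j). (n - j, j)" and i = "\<lambda>(i, j). (i + j, j)" and h = f]) auto
  have "((\<lambda>j. f (n - j, j)) has_sum (euler_coeff p n * (a * q) ^ n)) {..n}" for n
  proof -
    have "(\<Sum>j\<le>n. f (n - j, j))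
        = (\<Sum>j\<le>n. (-1) ^ n * p ^ (n choose 2) * a ^ n * (euler_coeff p j / qpoch q q (n - j)))"
    proof (rule sum.cong)
      fix j assume "j \<in> {..n}"
      \<comment> \<open>Splitting the sign as \<open>(-1) ^ n * (-1) ^ j\<close> supplies the sign
        of \<open>euler_coeff p j\<close> and leaves one independent of j.\<close>
      then have "(-1 :: complex) ^ n = (-1) ^ (n - j) * (-1) ^ j"
        by (simp flip: power_add)
      then have "(-1 :: complex) ^ n * (-1) ^ j = (-1) ^ (n - j)"
        by (simp add: mult.assoc flip: power_mult_distrib)
      then show "f (n - j, j)
          = (-1) ^ n * p ^ (n choose 2) * a ^ n * (euler_coeff p j / qpoch q q (n - j))"
        using \<open>j \<in> {..n}\<close> by (simp add: f_def euler_coeff_def mult_ac)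
    qed simp
    \<comment> \<open>The inner sum contributes \<open>q ^ n\<close>, which joins
      \<open>a ^ n\<close>, and the denominator that completes
      \<open>euler_coeff p n\<close>.\<close>
    also have "\<dots> = euler_coeff p n * (a * q) ^ n"
      unfolding sum_distrib_left[symmetric] p_def sum_euler_coeff_div_qpoch[OF assms(2)]
      by (simp add: euler_coeff_def power_mult_distrib)
    finally show ?thesis
      by (intro has_sum_finiteI) auto
  qed
  then have "((\<lambda>n. euler_coeff p n * (a * q) ^ n) has_sum S) UNIV"
    by (intro has_sum_SigmaD[OF diagonal]) simp
  then have "(\<lambda>n. euler_coeff p n * (a * q) ^ n) sums S"
    by (rule has_sum_imp_sums)
  then have "S = qpoch_inf (a * q) p"
    using euler_sums_qpoch_inf[OF p] by (rule sums_unique2)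
  with S show ?thesis
    by (simp add: f_def powi p_def)
qed

end
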